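(* Let $P$ be a finite poset with order $\leq$ and let $r\geq 1$ be an integer. Let $P_r$ be the set of all $r$-multichains $\mathfrak{p}: p_1\leq p_2\leq\cdots\leq p_r$ of elements of $P$. For a strictly increasing map $\imath:[r]\to[2r]$ define the relation $\preceq_\imath$ on $P_r$ by: for $\mathfrak{p}:p_1\leq\cdots\leq p_r$ and $\mathfrak{q}:q_1\leq\cdots\leq q_r$, $$\mathfrak{p}\preceq_\imath\mathfrak{q}\iff \text{for all } t,s\in[r]:\ p_t\geq q_s \text{ if } s\leq \imath(t)-t,\ \text{ and } p_t\leq q_s \text{ if } s>\imath(t)-t.$$ Let $G_\imath(P_r)$ be the simple graph on vertex set $P_r$ whose edges are the pairs $\{\mathfrak{p},\mathfrak{q}\}$ with $\mathfrak{p}\neq\mathfrak{q}$ and $\mathfrak{p}\preceq_\imath\mathfrak{q}$, and let $\Delta(G_\imath(P_r))$ be its clique complex (the simplicial complex of all subsets of $P_r$ that are cliques in $G_\imath(P_r)$). Let $\mathcal{I}$ be the set of all strictly increasing maps $\imath:[r]\to[2r]$ such that $\imath(1)=1$ and $\preceq_\imath$ is reflexive. Then the $f$-vector of $\Delta(G_\imath(P_r))$ is the same for all $\imath\in\mathcal{I}$.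
   Context: $[n]=\{1,\dots,n\}$. The $f$-vector of a simplicial complex is $(f_{-1},f_0,\dots)$ where $f_i$ is the number of faces of dimension $i$ (faces with $i+1$ elements), $f_{-1}=1$. *)

theory Defs
  imports Main "HOL-Library.FuncSet" "HOL-Library.Ramsey"
begin

text \<open>A poset is a carrier \<open>P\<close> with a relation \<open>le\<close> such that \<^term>\<open>partial_order_on P le\<close>;
  \<open>(x, y) \<in> le\<close> means \<open>x \<le> y\<close>. Maps on \<open>[r] = {1..r}\<close> are extensional functions, so that
  equality of multichains is equality of their \<open>r\<close> entries.\<close>

definition multichains :: "'a set \<Rightarrow> 'a rel \<Rightarrow> nat \<Rightarrow> (nat \<Rightarrow> 'a) set" where
  "multichains P le r =
     {p \<in> {1..r} \<rightarrow>\<^sub>E P. \<forall>s\<in>{1..r}. \<forall>t\<in>{1..r}. s \<le> t \<longrightarrow> (p s, p t) \<in> le}"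

text \<open>The subtraction below does not truncate on strictly increasing maps \<open>[r] \<rightarrow> [2r]\<close>, for which
  \<open>\<iota> t \<ge> t\<close>.\<close>

definition multichain_rel ::
    "'a set \<Rightarrow> 'a rel \<Rightarrow> nat \<Rightarrow> (nat \<Rightarrow> nat) \<Rightarrow> (nat \<Rightarrow> 'a) rel" where
  "multichain_rel P le r \<iota> =
     {(p, q). p \<in> multichains P le r \<and> q \<in> multichains P le r \<and>
        (\<forall>t\<in>{1..r}. \<forall>s\<in>{1..r}.
           (s \<le> \<iota> t - t \<longrightarrow> (q s, p t) \<in> le) \<and>
           (s > \<iota> t - t \<longrightarrow> (p t, q s) \<in> le))}"

definition multichain_edges ::
    "'a set \<Rightarrow> 'a rel \<Rightarrow> nat \<Rightarrow> (nat \<Rightarrow> nat) \<Rightarrow> (nat \<Rightarrow> 'a) set set" where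
  "multichain_edges P le r \<iota> =
     {{p, q} | p q. p \<noteq> q \<and> (p, q) \<in> multichain_rel P le r \<iota>}"

definition clique_complex :: "'v set \<Rightarrow> 'v set set \<Rightarrow> 'v set set" where
  "clique_complex V E = {F. F \<subseteq> V \<and> clique F E}"

text \<open>Indexed by dimension: entry \<open>i\<close> counts the faces with \<open>i + 1\<close> elements, starting at
  \<open>i = -1\<close>; all entries outside the range of dimensions of the complex are \<open>0\<close>.\<close>

definition f_vector :: "'v set set \<Rightarrow> int \<Rightarrow> nat" where
  "f_vector \<Delta> i = card {F \<in> \<Delta>. finite F \<and> int (card F) = i + 1}"

definition reflexive_maps :: "'a set \<Rightarrow> 'a rel \<Rightarrow> nat \<Rightarrow> (nat \<Rightarrow> nat) set" where
  "reflexive_maps P le r =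
     {\<iota> \<in> {1..r} \<rightarrow>\<^sub>E {1..2 * r}.
        strict_mono_on {1..r} \<iota> \<and> \<iota> 1 = 1 \<and>
        refl_on (multichains P le r) (multichain_rel P le r \<iota>)}"

end

theory Submission
  imports Defs
begin

text \<open>
  If \<open>P\<close> is an antichain, then \<open>\<iota> 1 = 1\<close> makes every relation the identity. Otherwise reflexivity
  forces \<open>\<iota> t - t \<in> {t - 1, t}\<close>, and \<open>p \<preceq> q\<close> says that the entries of \<open>p\<close> and \<open>q\<close> at a position
  \<open>t\<close> lie below those at all later positions, while \<open>p t \<le> q t\<close> or \<open>p t \<ge> q t\<close> according to the
  value of \<open>\<iota> t\<close>. Consider lists \<open>p\<^sub>1, \<dots>, p\<^sub>k\<close>, repetitions allowed, with \<open>p\<^sub>i \<preceq> p\<^sub>j\<close> for \<open>i < j\<close>.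
  Reversing the order of the entries at each position \<open>t\<close> of the second kind shows that the number
  of these lists does not depend on \<open>\<iota>\<close>. (This reversal does not preserve distinctness, so it is
  not a bijection of faces.) Each such list enumerates a clique in its unique linear order, and the
  number of lists of length \<open>k\<close> that enumerate a given clique of size \<open>j\<close> is the number of monotone
  surjections \<open>[k] \<rightarrow> [j]\<close>. This is a unitriangular system, which determines the \<open>f\<close>-vector.
\<close>

section \<open>Cliques and sorted lists\<close>

definition comparable_sets :: "'v set \<Rightarrow> 'v rel \<Rightarrow> 'v set set" where
  "comparable_sets V R = {F. F \<subseteq> V \<and> (\<forall>x\<in>F. \<forall>y\<in>F. x \<noteq> y \<longrightarrow> (x, y) \<in> R \<or> (y, x) \<in> R)}"

definition sorted_lists :: "'v set \<Rightarrow> 'v rel \<Rightarrow> nat \<Rightarrow> 'v list set" where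
  "sorted_lists V R k = {xs. set xs \<subseteq> V \<and> length xs = k \<and> sorted_wrt (\<lambda>x y. (x, y) \<in> R) xs}"

text \<open>A monotone map from \<open>{..<k}\<close> onto \<open>{..<j}\<close> is encoded as the
  list of its values, so that composing an enumeration with it is just \<open>map\<close>.\<close>

definition monotone_surjections :: "nat \<Rightarrow> nat \<Rightarrow> nat list set" where
  "monotone_surjections k j = {zs. length zs = k \<and> set zs = {..<j} \<and> sorted zs}"

text \<open>The diagonal coefficient of the triangular system: \<open>k\<close> entries that hit
  \<open>k\<close> values must be distinct.\<close>

lemma card_monotone_surjections_self: "card (monotone_surjections k k) = 1"
proof -
  have "zs = [0..<k]" if "zs \<in> monotone_surjections k k" for zs
  proof -
    from that have zs: "length zs = k" "set zs = {..<k}" "sorted zs"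
      by (auto simp: monotone_surjections_def)
    then have "distinct zs" by (simp add: card_distinct)
    with zs show ?thesis
      by (metis sorted_distinct_set_unique sorted_upt distinct_upt set_upt lessThan_atLeast0)
  qed
  moreover have "[0..<k] \<in> monotone_surjections k k"
    by (auto simp: monotone_surjections_def)
  ultimately have "monotone_surjections k k = {[0..<k]}" by blast
  then show ?thesis by simp
qed

text \<open>The relation \<open>R\<close> itself may fail to be transitive. On a comparable set it
  is still a total order, because it sits inside the transitive and antisymmetric relation
  \<open>Q\<close>; the induction splits off least elements.\<close>

lemma total_order_enumeration:
  assumes "finite F"
    and "\<And>x y. x \<in> F \<Longrightarrow> y \<in> F \<Longrightarrow> x \<noteq> y \<Longrightarrow> (x, y) \<in> R \<or> (y, x) \<in> R"
    and "R \<subseteq> Q" "trans Q" "antisym Q"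
  shows "\<exists>ys. distinct ys \<and> set ys = F \<and> sorted_wrt (\<lambda>x y. (x, y) \<in> R) ys"
  using assms(1,2)
proof (induction "card F" arbitrary: F)
  case 0
  then show ?case by (intro exI[of _ "[]"]) auto
next
  case (Suc n)
  let ?L = "\<lambda>x y. x \<noteq> y \<and> (x, y) \<in> R"
  have anti: "x = y" if "(x, y) \<in> R" "(y, x) \<in> R" for x y
    using that assms(3,5) by (blast dest: antisymD)
  have "asymp_on F ?L" using anti by (auto intro!: asymp_onI)
  moreover have "transp_on F ?L"
  proof (rule transp_onI)
    fix x y z assume *: "x \<in> F" "y \<in> F" "z \<in> F" "?L x y" "?L y z"
    then have "(x, z) \<in> Q" using assms(3,4) by (blast dest: transD)
    moreover have "x \<noteq> z" using * anti by blast
    \<comment> \<open>Comparability leaves \<open>(x, z)\<close> or \<open>(z, x)\<close> in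
      \<open>R\<close>; the latter, combined with \<open>(x, z) \<in> Q\<close>, would force
      \<open>x = z\<close>.\<close>
    ultimately show "?L x z"
      using Suc.prems(2)[of x z] * assms(3,5) by (blast dest: antisymD)
  qed
  moreover have "totalp_on F ?L" using Suc.prems(2) by (auto intro!: totalp_onI)
  moreover have "F \<noteq> {}" using Suc.hyps(2) by auto
  ultimately obtain m where m: "m \<in> F" "\<forall>x\<in>F. x \<noteq> m \<longrightarrow> ?L m x"
    using Finite_Set.bex_least_element[of F ?L] Suc.prems(1) by blast
  have "n = card (F - {m})" using Suc.hyps(2) Suc.prems(1) m(1) by simp
  then obtain ys where "distinct ys \<and> set ys = F - {m} \<and> sorted_wrt (\<lambda>x y. (x, y) \<in> R) ys"
    using Suc.hyps(1)[of "F - {m}"] Suc.prems by auto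
  then show ?case using m by (intro exI[of _ "m # ys"]) auto
qed

text \<open>Along the enumeration \<open>ys\<close> of \<open>F\<close>, the relation
  \<open>R\<close> becomes the order of indices. The sorted lists onto \<open>F\<close> are
  therefore the composites of \<open>ys\<close> with monotone surjections.\<close>

lemma card_sorted_lists_onto:
  assumes "finite F"
    and tot: "\<And>x y. x \<in> F \<Longrightarrow> y \<in> F \<Longrightarrow> x \<noteq> y \<Longrightarrow> (x, y) \<in> R \<or> (y, x) \<in> R"
    and refl: "\<And>x. x \<in> F \<Longrightarrow> (x, x) \<in> R"
    and Q: "R \<subseteq> Q" "trans Q" "antisym Q"
  shows "card {xs. set xs = F \<and> length xs = k \<and> sorted_wrt (\<lambda>x y. (x, y) \<in> R) xs} =
    card (monotone_surjections k (card F))" (is "card ?X = card ?Z")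
proof -
  from total_order_enumeration[of F R Q] assms obtain ys where
    ys: "distinct ys" "set ys = F" and sorted: "sorted_wrt (\<lambda>x y. (x, y) \<in> R) ys"
    by blast
  define n where "n = card F"
  have len: "length ys = n" using ys distinct_card n_def by metis
  have inj: "inj_on ((!) ys) {..<n}"
    using ys(1) len by (intro inj_on_nth) auto
  have img: "(!) ys ` {..<n} = F"
    using ys(2) len by (auto simp: set_conv_nth)
  have iff: "(ys ! i, ys ! j) \<in> R \<longleftrightarrow> i \<le> j" if "i < n" "j < n" for i j
  proof
    assume "i \<le> j"
    then show "(ys ! i, ys ! j) \<in> R"
      using that sorted_wrt_nth_less[OF sorted, of i j] refl[of "ys ! i"] img len
      by (cases "i = j") auto
  next
    assume R: "(ys ! i, ys ! j) \<in> R"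
    show "i \<le> j"
    proof (rule ccontr)
      assume "\<not> i \<le> j"
      then have "(ys ! j, ys ! i) \<in> R"
        using that sorted_wrt_nth_less[OF sorted, of j i] len by auto
      then have "ys ! i = ys ! j" using R Q by (blast dest: antisymD)
      then show False using inj that \<open>\<not> i \<le> j\<close> by (auto dest: inj_onD)
    qed
  qed
  have sorted_map: "sorted_wrt (\<lambda>x y. (x, y) \<in> R) (map ((!) ys) zs) \<longleftrightarrow> sorted zs"
    if "set zs \<subseteq> {..<n}" for zs
    using that iff by (induction zs) auto
  have "?X = map ((!) ys) ` monotone_surjections k n"
  proof (intro equalityI subsetI)
    fix xs assume xs: "xs \<in> ?X"
    then have "xs \<in> lists ((!) ys ` {..<n})" using img by (simp add: in_lists_conv_set)
    then obtain zs where zs: "xs = map ((!) ys) zs" "set zs \<subseteq> {..<n}"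
      unfolding lists_image by (auto simp: in_lists_conv_set)
    have "(!) ys ` set zs = (!) ys ` {..<n}" using xs zs img by simp
    then have "set zs = {..<n}"
      using inj zs(2) inj_on_image_eq_iff by blast
    moreover have "sorted zs" "length zs = k"
      using xs zs sorted_map by auto
    ultimately show "xs \<in> map ((!) ys) ` monotone_surjections k n"
      using zs(1) by (auto simp: monotone_surjections_def)
  next
    fix xs assume "xs \<in> map ((!) ys) ` monotone_surjections k n"
    then obtain zs where "zs \<in> monotone_surjections k n" "xs = map ((!) ys) zs" by blast
    then show "xs \<in> ?X"
      using sorted_map[of zs] img by (auto simp: monotone_surjections_def)
  qed
  moreover have "inj_on (map ((!) ys)) (monotone_surjections k n)"
    by (rule inj_on_mapI, rule inj_on_subset[OF inj]) (auto simp: monotone_surjections_def)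
  ultimately show ?thesis by (simp add: card_image n_def)
qed

text \<open>Sorted lists are grouped by their set of entries, which is a comparable set with at most
  \<open>k\<close> elements.\<close>

lemma card_sorted_lists:
  assumes "finite V" and refl: "\<And>x. x \<in> V \<Longrightarrow> (x, x) \<in> R"
    and Q: "R \<subseteq> Q" "trans Q" "antisym Q"
  shows "card (sorted_lists V R k) =
    (\<Sum>j\<le>k. card {F \<in> comparable_sets V R. card F = j} * card (monotone_surjections k j))"
proof -
  define X where
    "X F = {xs. set xs = F \<and> length xs = k \<and> sorted_wrt (\<lambda>x y. (x, y) \<in> R) xs}" for F
  define C where "C j = {F \<in> comparable_sets V R. card F = j}" for j
  have sub: "F \<subseteq> V" if "F \<in> C j" for F j
    using that by (auto simp: C_def comparable_sets_def)
  have finC: "finite (C j)" for j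
    by (rule finite_subset[of _ "Pow V"]) (use sub \<open>finite V\<close> in auto)
  have finX: "finite (X F)" if "F \<in> C j" for F j
    by (rule finite_subset[OF _ finite_lists_length_eq[of V k]])
      (use sub[OF that] \<open>finite V\<close> in \<open>auto simp: X_def\<close>)
  have comparable: "set xs \<in> comparable_sets V R" if "xs \<in> sorted_lists V R k" for xs
  proof -
    from that have xs: "set xs \<subseteq> V" "sorted_wrt (\<lambda>x y. (x, y) \<in> R) xs"
      by (auto simp: sorted_lists_def)
    have "(x, y) \<in> R \<or> (y, x) \<in> R" if xy: "x \<in> set xs" "y \<in> set xs" "x \<noteq> y" for x y
    proof -
      from xy obtain i j where ij: "i < length xs" "j < length xs" "x = xs ! i" "y = xs ! j"
        by (metis in_set_conv_nth)
      with xy(3) have "i < j \<or> j < i" by (metis linorder_neqE_nat)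
      then show ?thesis using ij sorted_wrt_nth_less[OF xs(2)] by blast
    qed
    then show ?thesis using xs(1) by (auto simp: comparable_sets_def)
  qed
  have "sorted_lists V R k = (\<Union>j\<le>k. \<Union>F\<in>C j. X F)"
  proof (intro equalityI subsetI)
    fix xs assume xs: "xs \<in> sorted_lists V R k"
    then have "xs \<in> X (set xs)" "set xs \<in> C (card (set xs))" "card (set xs) \<le> k"
      using comparable[OF xs] card_length[of xs] by (auto simp: X_def C_def sorted_lists_def)
    then show "xs \<in> (\<Union>j\<le>k. \<Union>F\<in>C j. X F)" by blast
  next
    fix xs assume "xs \<in> (\<Union>j\<le>k. \<Union>F\<in>C j. X F)"
    then show "xs \<in> sorted_lists V R k"
      using sub by (fastforce simp: X_def sorted_lists_def)
  qed
  also have "card \<dots> = (\<Sum>j\<le>k. card (\<Union>F\<in>C j. X F))"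
    using finC finX by (intro card_UN_disjoint) (auto simp: X_def C_def)
  also have "\<dots> = (\<Sum>j\<le>k. card (C j) * card (monotone_surjections k j))"
  proof (rule sum.cong[OF HOL.refl])
    fix j
    have "card (\<Union>F\<in>C j. X F) = (\<Sum>F\<in>C j. card (X F))"
      using finC finX by (intro card_UN_disjoint) (auto simp: X_def)
    also have "\<dots> = (\<Sum>F\<in>C j. card (monotone_surjections k j))"
    proof (rule sum.cong[OF HOL.refl])
      fix F assume F: "F \<in> C j"
      then have "finite F" "card F = j"
        using sub finite_subset[OF _ \<open>finite V\<close>] by (auto simp: C_def)
      with F show "card (X F) = card (monotone_surjections k j)"
        unfolding X_def using card_sorted_lists_onto[of F R Q k] refl sub[OF F] Q
        by (auto simp: C_def comparable_sets_def)
    qed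
    finally show "card (\<Union>F\<in>C j. X F) = card (C j) * card (monotone_surjections k j)" by simp
  qed
  finally show ?thesis by (simp add: C_def)
qed

text \<open>In the formula for lists of length \<open>k\<close>, the unknown with
  \<open>j = k\<close> has coefficient 1 and all others have \<open>j < k\<close>, so strong
  induction solves the system.\<close>

lemma card_comparable_sets_eqI:
  assumes "finite V"
    and "\<And>x. x \<in> V \<Longrightarrow> (x, x) \<in> R" "R \<subseteq> Q" "trans Q" "antisym Q"
    and "\<And>x. x \<in> V \<Longrightarrow> (x, x) \<in> R'" "R' \<subseteq> Q'" "trans Q'" "antisym Q'"
    and eq: "\<And>k. card (sorted_lists V R k) = card (sorted_lists V R' k)"
  shows "card {F \<in> comparable_sets V R. card F = k} = card {F \<in> comparable_sets V R'. card F = k}"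
proof (induction k rule: less_induct)
  case (less k)
  let ?f = "\<lambda>R j. card {F \<in> comparable_sets V R. card F = j}"
  let ?a = "\<lambda>j. card (monotone_surjections k j)"
  have "(\<Sum>j\<le>k. ?f R j * ?a j) = (\<Sum>j\<le>k. ?f R' j * ?a j)"
    using card_sorted_lists[OF assms(1-5), of k] card_sorted_lists[OF assms(1,6-9), of k] eq[of k]
    by simp
  then have "(\<Sum>j<k. ?f R j * ?a j) + ?f R k = (\<Sum>j<k. ?f R' j * ?a j) + ?f R' k"
    by (simp add: lessThan_Suc_atMost[symmetric] card_monotone_surjections_self)
  moreover have "(\<Sum>j<k. ?f R j * ?a j) = (\<Sum>j<k. ?f R' j * ?a j)"
    using less by (intro sum.cong) auto
  ultimately show ?case by simp
qed

section \<open>Relations on multichains with prescribed directions\<close>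

text \<open>The relation of the map with \<open>\<iota> t - t = t\<close> for \<open>t \<in> D\<close> and \<open>\<iota> t - t = t - 1\<close> otherwise.\<close>

definition directed_rel :: "'a set \<Rightarrow> 'a rel \<Rightarrow> nat \<Rightarrow> nat set \<Rightarrow> (nat \<Rightarrow> 'a) rel" where
  "directed_rel P le r D =
     {(p, q). p \<in> multichains P le r \<and> q \<in> multichains P le r \<and>
        (\<forall>t\<in>{1..r}. if t \<in> D then (q t, p t) \<in> le else (p t, q t) \<in> le) \<and>
        (\<forall>t\<in>{1..r}. \<forall>s\<in>{1..r}. t < s \<longrightarrow> (p t, q s) \<in> le \<and> (q t, p s) \<in> le)}"

text \<open>This is a product of copies of \<open>le\<close> and its converse. It serves as the
  ambient order \<open>Q\<close>, since \<open>directed_rel\<close> is not transitive in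
  general.\<close>

definition directed_order :: "'a set \<Rightarrow> 'a rel \<Rightarrow> nat \<Rightarrow> nat set \<Rightarrow> (nat \<Rightarrow> 'a) rel" where
  "directed_order P le r D =
     {(p, q). p \<in> multichains P le r \<and> q \<in> multichains P le r \<and>
        (\<forall>t\<in>{1..r}. if t \<in> D then (q t, p t) \<in> le else (p t, q t) \<in> le)}"

lemma directed_rel_subset_order: "directed_rel P le r D \<subseteq> directed_order P le r D"
  by (auto simp: directed_rel_def directed_order_def)

lemma trans_directed_order:
  assumes "trans le"
  shows "trans (directed_order P le r D)"
proof (rule transI)
  fix p q w assume "(p, q) \<in> directed_order P le r D" "(q, w) \<in> directed_order P le r D"
  then show "(p, w) \<in> directed_order P le r D"
    using transD[OF assms] unfolding directed_order_def by (simp split: if_splits) metis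
qed

lemma antisym_directed_order:
  assumes "antisym le"
  shows "antisym (directed_order P le r D)"
proof (rule antisymI)
  fix p q assume *: "(p, q) \<in> directed_order P le r D" "(q, p) \<in> directed_order P le r D"
  then have "p \<in> extensional {1..r}" "q \<in> extensional {1..r}"
    by (auto simp: directed_order_def multichains_def PiE_def)
  moreover have "p t = q t" if "t \<in> {1..r}" for t
    using * that antisymD[OF assms] by (cases "t \<in> D") (auto simp: directed_order_def)
  ultimately show "p = q" by (rule extensionalityI)
qed

lemma refl_directed_rel:
  "p \<in> multichains P le r \<Longrightarrow> (p, p) \<in> directed_rel P le r D"
  by (auto simp: directed_rel_def multichains_def)

text \<open>The conditions between different positions hold for all pairs of list entries, whatever
  their order in the list. Only the comparisons within one position see \<open>D\<close> and the
  list order.\<close>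

lemma sorted_lists_directed_rel_iff:
  "xs \<in> sorted_lists (multichains P le r) (directed_rel P le r D) k \<longleftrightarrow>
     length xs = k \<and>
     (\<forall>i<k. xs ! i \<in> {1..r} \<rightarrow>\<^sub>E P) \<and>
     (\<forall>i<k. \<forall>j<k. \<forall>t\<in>{1..r}. \<forall>s\<in>{1..r}. t < s \<longrightarrow> ((xs ! i) t, (xs ! j) s) \<in> le) \<and>
     (\<forall>i<k. \<forall>j<k. \<forall>t\<in>{1..r}. i \<le> j \<longrightarrow>
        (if t \<in> D then ((xs ! j) t, (xs ! i) t) \<in> le else ((xs ! i) t, (xs ! j) t) \<in> le))"
  (is "?L \<longleftrightarrow> ?R")
proof
  assume L: ?L
  then have len: "length xs = k" and sub: "set xs \<subseteq> multichains P le r"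
    and sorted: "sorted_wrt (\<lambda>x y. (x, y) \<in> directed_rel P le r D) xs"
    by (auto simp: sorted_lists_def)
  have mc: "xs ! i \<in> multichains P le r" if "i < k" for i
    using that len sub by auto
  have rel: "(xs ! i, xs ! j) \<in> directed_rel P le r D" if "i \<le> j" "j < k" for i j
    using that sorted_wrt_nth_less[OF sorted, of i j] refl_directed_rel[OF mc] len
    by (cases "i = j") auto
  have "((xs ! i) t, (xs ! j) s) \<in> le"
    if "i < k" "j < k" "t \<in> {1..r}" "s \<in> {1..r}" "t < s" for i j t s
    using rel[of i j] rel[of j i] that by (cases "i \<le> j") (auto simp: directed_rel_def)
  moreover have "if t \<in> D then ((xs ! j) t, (xs ! i) t) \<in> le else ((xs ! i) t, (xs ! j) t) \<in> le"
    if "i < k" "j < k" "t \<in> {1..r}" "i \<le> j" for i j t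
    using rel[of i j] that by (auto simp: directed_rel_def)
  moreover have "xs ! i \<in> {1..r} \<rightarrow>\<^sub>E P" if "i < k" for i
    using mc[OF that] by (simp add: multichains_def)
  ultimately show ?R using len by blast
next
  assume R: ?R
  then have len: "length xs = k" by blast
  have mc: "xs ! i \<in> multichains P le r" if i: "i < k" for i
  proof -
    have "((xs ! i) s, (xs ! i) t) \<in> le" if "s \<in> {1..r}" "t \<in> {1..r}" "s \<le> t" for s t
    proof (cases "s = t")
      case True
      \<comment> \<open>The pair \<open>i = j\<close> of the last condition supplies reflexivity of
        \<open>le\<close> at this value, which is not assumed for \<open>le\<close> in
        general.\<close>
      have "if t \<in> D then ((xs ! i) t, (xs ! i) t) \<in> le else ((xs ! i) t, (xs ! i) t) \<in> le"
        using R i that by blast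
      then show ?thesis using True by (simp split: if_splits)
    next
      case False
      then have "s < t" using that by simp
      then show ?thesis using R i that by blast
    qed
    then show ?thesis using R i by (auto simp: multichains_def)
  qed
  have "(xs ! i, xs ! j) \<in> directed_rel P le r D" if "i < j" "j < k" for i j
  proof -
    have "i < k" "i \<le> j" using that by auto
    then have "\<forall>t\<in>{1..r}. if t \<in> D then ((xs ! j) t, (xs ! i) t) \<in> le else ((xs ! i) t, (xs ! j) t) \<in> le"
      and "\<forall>t\<in>{1..r}. \<forall>s\<in>{1..r}. t < s \<longrightarrow> ((xs ! i) t, (xs ! j) s) \<in> le \<and> ((xs ! j) t, (xs ! i) s) \<in> le"
      using R that by blast+
    then show ?thesis using mc[OF \<open>i < k\<close>] mc[OF \<open>j < k\<close>] by (simp add: directed_rel_def)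
  qed
  moreover have "set xs \<subseteq> multichains P le r"
    using mc len by (auto simp: in_set_conv_nth)
  ultimately show ?L using len by (auto simp: sorted_lists_def sorted_wrt_iff_nth_less)
qed

text \<open>The list is read as a matrix with the multichains as rows and the positions
  \<open>t\<close> as columns; the columns in \<open>D\<close> are turned upside down.
  \<open>restrict\<close> keeps the rows extensional, so that doing this twice can restore the
  list.\<close>

definition reverse_columns :: "nat \<Rightarrow> nat set \<Rightarrow> (nat \<Rightarrow> 'a) list \<Rightarrow> (nat \<Rightarrow> 'a) list" where
  "reverse_columns r D xs =
     map (\<lambda>i. restrict (\<lambda>t. (xs ! (if t \<in> D then length xs - 1 - i else i)) t) {1..r})
       [0..<length xs]"

lemma length_reverse_columns [simp]: "length (reverse_columns r D xs) = length xs"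
  by (simp add: reverse_columns_def)

lemma nth_reverse_columns:
  "i < length xs \<Longrightarrow> t \<in> {1..r} \<Longrightarrow>
    (reverse_columns r D xs ! i) t = (xs ! (if t \<in> D then length xs - 1 - i else i)) t"
  by (simp add: reverse_columns_def)

lemma reverse_columns_extensional:
  "i < length xs \<Longrightarrow> reverse_columns r D xs ! i \<in> extensional {1..r}"
  by (simp add: reverse_columns_def)

lemma reverse_columns_reverse_columns:
  assumes "\<And>i. i < length xs \<Longrightarrow> xs ! i \<in> extensional {1..r}"
  shows "reverse_columns r D (reverse_columns r D xs) = xs"
proof (rule nth_equalityI)
  fix i assume "i < length (reverse_columns r D (reverse_columns r D xs))"
  then have i: "i < length xs" by simp
  then have "length xs - 1 - i < length xs" "length xs - 1 - (length xs - 1 - i) = i" by auto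
  with i have "(reverse_columns r D (reverse_columns r D xs) ! i) t = (xs ! i) t"
    if "t \<in> {1..r}" for t
    using that by (simp add: nth_reverse_columns)
  then show "reverse_columns r D (reverse_columns r D xs) ! i = xs ! i"
    using i assms by (intro extensionalityI[of _ "{1..r}"] reverse_columns_extensional) simp_all
qed simp

text \<open>Conditions between different columns range over all pairs of rows and survive any
  permutation within a column. Reversing a column swaps its direction, so \<open>D\<close> changes
  by symmetric difference with \<open>A\<close>.\<close>

lemma reverse_columns_in_sorted_lists:
  assumes "xs \<in> sorted_lists (multichains P le r) (directed_rel P le r D) k"
    and D': "D' = (D - A) \<union> (A - D)"
  shows "reverse_columns r A xs \<in> sorted_lists (multichains P le r) (directed_rel P le r D') k"
proof -
  let ?m = "\<lambda>i t. if t \<in> A then k - 1 - i else i"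
  from assms(1) have len: "length xs = k"
    and PiE: "\<And>i. i < k \<Longrightarrow> xs ! i \<in> {1..r} \<rightarrow>\<^sub>E P"
    and less: "\<And>i j t s. i < k \<Longrightarrow> j < k \<Longrightarrow> t \<in> {1..r} \<Longrightarrow> s \<in> {1..r} \<Longrightarrow> t < s \<Longrightarrow>
      ((xs ! i) t, (xs ! j) s) \<in> le"
    and dir: "\<And>i j t. i < k \<Longrightarrow> j < k \<Longrightarrow> t \<in> {1..r} \<Longrightarrow> i \<le> j \<Longrightarrow>
      (if t \<in> D then ((xs ! j) t, (xs ! i) t) \<in> le else ((xs ! i) t, (xs ! j) t) \<in> le)"
    unfolding sorted_lists_directed_rel_iff by blast+
  have nth: "(reverse_columns r A xs ! i) t = (xs ! ?m i t) t" if "i < k" "t \<in> {1..r}" for i t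
    using that len nth_reverse_columns[of i xs t r A] by simp
  have m: "?m i t < k" if "i < k" for i t using that by auto
  have "reverse_columns r A xs ! i \<in> {1..r} \<rightarrow>\<^sub>E P" if i: "i < k" for i
  proof (rule PiE_I)
    fix t assume t: "t \<in> {1..r}"
    show "(reverse_columns r A xs ! i) t \<in> P"
      using PiE_mem[OF PiE[OF m[OF i]] t] by (simp only: nth[OF i t])
  next
    fix t assume "t \<notin> {1..r}"
    then show "(reverse_columns r A xs ! i) t = undefined"
      using reverse_columns_extensional[of i xs r A] i len by (simp add: extensional_def)
  qed
  moreover have "((reverse_columns r A xs ! i) t, (reverse_columns r A xs ! j) s) \<in> le"
    if "i < k" "j < k" "t \<in> {1..r}" "s \<in> {1..r}" "t < s" for i j t s
    using less[OF m[OF that(1), of t] m[OF that(2), of s] that(3-5)] nth that by metis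
  moreover have "if t \<in> D' then ((reverse_columns r A xs ! j) t, (reverse_columns r A xs ! i) t) \<in> le
      else ((reverse_columns r A xs ! i) t, (reverse_columns r A xs ! j) t) \<in> le"
    if "i < k" "j < k" "t \<in> {1..r}" "i \<le> j" for i j t
  proof (cases "t \<in> A")
    case True
    have "k - 1 - j \<le> k - 1 - i" using that by simp
    then have "if t \<in> D then ((xs ! ?m i t) t, (xs ! ?m j t) t) \<in> le
        else ((xs ! ?m j t) t, (xs ! ?m i t) t) \<in> le"
      using dir[OF m[OF that(2), of t] m[OF that(1), of t] that(3)] True by simp
    then show ?thesis using nth[OF that(1,3)] nth[OF that(2,3)] True D' by (simp split: if_splits)
  next
    case False
    then show ?thesis using nth[OF that(1,3)] nth[OF that(2,3)] dir[OF that] D'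
      by (simp split: if_splits)
  qed
  ultimately show ?thesis unfolding sorted_lists_directed_rel_iff using len by simp
qed

lemma card_sorted_lists_directed_rel:
  "card (sorted_lists (multichains P le r) (directed_rel P le r D) k) =
   card (sorted_lists (multichains P le r) (directed_rel P le r D') k)"
proof -
  define A where "A = (D - D') \<union> (D' - D)"
  have D': "D' = (D - A) \<union> (A - D)" and D: "D = (D' - A) \<union> (A - D')"
    by (auto simp: A_def)
  have involution: "reverse_columns r A (reverse_columns r A xs) = xs"
    if "xs \<in> sorted_lists (multichains P le r) (directed_rel P le r B) k" for xs B
    using that unfolding sorted_lists_directed_rel_iff
    by (intro reverse_columns_reverse_columns) (auto simp: PiE_def)
  have "bij_betw (reverse_columns r A)
      (sorted_lists (multichains P le r) (directed_rel P le r D) k)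
      (sorted_lists (multichains P le r) (directed_rel P le r D') k)"
    using involution reverse_columns_in_sorted_lists[OF _ D'] reverse_columns_in_sorted_lists[OF _ D]
    by (intro bij_betw_byWitness[where f' = "reverse_columns r A"]) blast+
  then show ?thesis by (rule bij_betw_same_card)
qed

section \<open>The relations of reflexive maps\<close>

lemma finite_multichains: "finite P \<Longrightarrow> finite (multichains P le r)"
  by (rule finite_subset[of _ "{1..r} \<rightarrow>\<^sub>E P"]) (auto simp: multichains_def intro: finite_PiE)

lemma multichain_rel_antichain:
  assumes "\<iota> \<in> reflexive_maps P le r" "r \<ge> 1" and anti: "\<And>a b. (a, b) \<in> le \<Longrightarrow> a = b"
  shows "multichain_rel P le r \<iota> = Id_on (multichains P le r)"
proof (intro equalityI subsetI)
  fix x assume "x \<in> Id_on (multichains P le r)"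
  then show "x \<in> multichain_rel P le r \<iota>"
    using assms(1) by (auto simp: reflexive_maps_def dest: refl_onD)
next
  fix x assume "x \<in> multichain_rel P le r \<iota>"
  then obtain p q where x: "x = (p, q)" and pq: "(p, q) \<in> multichain_rel P le r \<iota>"
    by (cases x) auto
  then have mc: "p \<in> multichains P le r" "q \<in> multichains P le r"
    by (auto simp: multichain_rel_def)
  \<comment> \<open>Hence \<open>\<iota> 1 - 1 = 0\<close>, and every \<open>s\<close> falls under
    the condition that \<open>p 1\<close> lies below \<open>q s\<close>.\<close>
  have "\<iota> 1 = 1" using assms(1) by (simp add: reflexive_maps_def)
  then have p1: "p 1 = q s" if "s \<in> {1..r}" for s
    using pq that \<open>r \<ge> 1\<close> by (auto simp: multichain_rel_def intro!: anti)
  have "p 1 = p s" if "s \<in> {1..r}" for s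
    using mc(1) that \<open>r \<ge> 1\<close> by (auto simp: multichains_def intro!: anti)
  with p1 have "p s = q s" if "s \<in> {1..r}" for s using that by metis
  moreover have "p \<in> extensional {1..r}" "q \<in> extensional {1..r}"
    using mc by (auto simp: multichains_def PiE_def)
  ultimately have "p = q" by (intro extensionalityI)
  then show "x \<in> Id_on (multichains P le r)" using x mc by auto
qed

text \<open>Reflexivity is tested on the multichains that jump once, from \<open>a\<close> to \<open>b\<close>.\<close>

lemma multichain_rel_eq_directed_rel:
  assumes "\<iota> \<in> reflexive_maps P le r" and po: "partial_order_on P le"
    and ab: "(a, b) \<in> le" "a \<noteq> b"
  shows "multichain_rel P le r \<iota> = directed_rel P le r {t. t \<le> \<iota> t - t}"
proof -
  have P: "a \<in> P" "b \<in> P" and refl: "(a, a) \<in> le" "(b, b) \<in> le" and ba: "(b, a) \<notin> le"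
    using po ab by (auto simp: partial_order_on_def preorder_on_def dest: refl_onD antisymD)
  define step where "step m = restrict (\<lambda>s. if s \<le> m then a else b) {1..r}" for m :: nat
  have "step m \<in> multichains P le r" for m
    using P refl ab(1) by (auto simp: step_def multichains_def)
  then have "(step m, step m) \<in> multichain_rel P le r \<iota>" for m
    using assms(1) by (auto simp: reflexive_maps_def dest: refl_onD)
  then have step1: "s \<le> \<iota> t - t \<Longrightarrow> (step m s, step m t) \<in> le"
    and step2: "\<iota> t - t < s \<Longrightarrow> (step m t, step m s) \<in> le"
    if "s \<in> {1..r}" "t \<in> {1..r}" for m s t
    using that unfolding multichain_rel_def by blast+
  \<comment> \<open>The multichain \<open>step s\<close> takes the value \<open>a\<close> at
    \<open>s\<close> and \<open>b\<close> at \<open>t\<close>; if the claim failed,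
    \<open>step2\<close> would put \<open>b\<close> below \<open>a\<close>.\<close>
  have lower: "s \<le> \<iota> t - t" if "s \<in> {1..r}" "t \<in> {1..r}" "s < t" for s t
    using step2[of s t s] that ba by (auto simp: step_def not_le[symmetric])
  \<comment> \<open>Here \<open>step t\<close> jumps directly after \<open>t\<close>, and
    \<open>step1\<close> would put \<open>b\<close> below \<open>a\<close>.\<close>
  have upper: "\<iota> t - t < s" if "s \<in> {1..r}" "t \<in> {1..r}" "t < s" for s t
    using step1[of s t t] that ba by (auto simp: step_def not_le[symmetric])
  have "((\<forall>t\<in>{1..r}. \<forall>s\<in>{1..r}. (s \<le> \<iota> t - t \<longrightarrow> (q s, p t) \<in> le) \<and>
          (s > \<iota> t - t \<longrightarrow> (p t, q s) \<in> le)) \<longleftrightarrow>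
        (\<forall>t\<in>{1..r}. if t \<in> {t. t \<le> \<iota> t - t} then (q t, p t) \<in> le else (p t, q t) \<in> le) \<and>
        (\<forall>t\<in>{1..r}. \<forall>s\<in>{1..r}. t < s \<longrightarrow> (p t, q s) \<in> le \<and> (q t, p s) \<in> le))"
    (is "?L \<longleftrightarrow> ?R1 \<and> ?R2") for p q
  proof
    assume L: ?L
    then have ?R1 by (auto simp: not_le)
    moreover from L have ?R2 using lower upper by blast
    ultimately show "?R1 \<and> ?R2" ..
  next
    assume R: "?R1 \<and> ?R2"
    show ?L
    proof (intro ballI)
      fix t s assume ts: "t \<in> {1..r}" "s \<in> {1..r}"
      consider "s < t" | "s = t" | "t < s" by linarith
      then show "(s \<le> \<iota> t - t \<longrightarrow> (q s, p t) \<in> le) \<and> (s > \<iota> t - t \<longrightarrow> (p t, q s) \<in> le)"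
      proof cases
        case 1
        then have "s \<le> \<iota> t - t" "(q s, p t) \<in> le" using lower R ts by blast+
        then show ?thesis by simp
      next
        case 2
        then show ?thesis using R ts(1) by (auto simp: not_le split: if_splits)
      next
        case 3
        then have "\<iota> t - t < s" "(p t, q s) \<in> le" using upper R ts by blast+
        then show ?thesis by simp
      qed
    qed
  qed
  then show ?thesis unfolding multichain_rel_def directed_rel_def by simp
qed

section \<open>From relations to f-vectors of clique complexes\<close>

lemma clique_complex_multichain_edges:
  "clique_complex (multichains P le r) (multichain_edges P le r \<iota>) =
     comparable_sets (multichains P le r) (multichain_rel P le r \<iota>)"
proof -
  have "{x, y} \<in> multichain_edges P le r \<iota> \<longleftrightarrow>
      (x, y) \<in> multichain_rel P le r \<iota> \<or> (y, x) \<in> multichain_rel P le r \<iota>"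
    if "x \<noteq> y" for x y
    using that by (auto simp: multichain_edges_def doubleton_eq_iff)
  then show ?thesis by (auto simp: clique_complex_def comparable_sets_def clique_def)
qed

lemma f_vector_comparable_sets:
  assumes "finite V"
  shows "f_vector (comparable_sets V R) i =
    (if i < -1 then 0 else card {F \<in> comparable_sets V R. card F = nat (i + 1)})"
proof -
  have "finite F" if "F \<in> comparable_sets V R" for F
    using that finite_subset[OF _ assms] by (auto simp: comparable_sets_def)
  \<comment> \<open>The case \<open>i < -1\<close> is separate because \<open>nat (i + 1)\<close>
    would truncate to 0 and count the empty face.\<close>
  then have "{F \<in> comparable_sets V R. finite F \<and> int (card F) = i + 1} =
      (if i < -1 then {} else {F \<in> comparable_sets V R. card F = nat (i + 1)})"
    by auto
  then show ?thesis by (simp add: f_vector_def)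
qed

theorem theorem1p2:
  fixes P :: "'a set" and le :: "'a rel" and r :: nat
  assumes "finite P" and "partial_order_on P le" and "r \<ge> 1"
  shows "\<forall>\<iota> \<in> reflexive_maps P le r. \<forall>\<kappa> \<in> reflexive_maps P le r.
    f_vector (clique_complex (multichains P le r) (multichain_edges P le r \<iota>)) =
    f_vector (clique_complex (multichains P le r) (multichain_edges P le r \<kappa>))"
proof (intro ballI)
  fix \<iota> \<kappa> assume maps: "\<iota> \<in> reflexive_maps P le r" "\<kappa> \<in> reflexive_maps P le r"
  let ?V = "multichains P le r"
  show "f_vector (clique_complex ?V (multichain_edges P le r \<iota>)) =
    f_vector (clique_complex ?V (multichain_edges P le r \<kappa>))"
  \<comment> \<open>On an antichain all multichains are constant, so reflexivity does not restrict
    \<open>\<iota>\<close>, and the description by a set \<open>D\<close> needs a strict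
    pair.\<close>
  proof (cases "\<exists>a b. (a, b) \<in> le \<and> a \<noteq> b")
    case False
    then have "multichain_rel P le r \<iota> = multichain_rel P le r \<kappa>"
      using multichain_rel_antichain maps \<open>r \<ge> 1\<close> by metis
    then show ?thesis by (simp add: clique_complex_multichain_edges)
  next
    case True
    then obtain a b where ab: "(a, b) \<in> le" "a \<noteq> b" by blast
    obtain D D' where rel: "multichain_rel P le r \<iota> = directed_rel P le r D"
      "multichain_rel P le r \<kappa> = directed_rel P le r D'"
      using multichain_rel_eq_directed_rel[OF maps(1) assms(2) ab]
        multichain_rel_eq_directed_rel[OF maps(2) assms(2) ab] by blast
    have "trans le" "antisym le"
      using assms(2) by (auto simp: partial_order_on_def preorder_on_def)
    then have "card {F \<in> comparable_sets ?V (directed_rel P le r D). card F = k} =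
        card {F \<in> comparable_sets ?V (directed_rel P le r D'). card F = k}" for k
      using finite_multichains[OF assms(1)]
      by (intro card_comparable_sets_eqI[where Q = "directed_order P le r D"
            and Q' = "directed_order P le r D'"] refl_directed_rel directed_rel_subset_order
          trans_directed_order antisym_directed_order card_sorted_lists_directed_rel)
    then show ?thesis
      by (auto simp: fun_eq_iff clique_complex_multichain_edges rel
          f_vector_comparable_sets[OF finite_multichains[OF assms(1)]])
  qed
qed

end
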